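(* Let $\mathcal{P}=(X,\prec)$ be a finite poset. Let $A,B\subseteq X$ be lower order ideals and let $C,D\subseteq X$ be upper order ideals of $\mathcal{P}$, such that $A,B,C,D$ are pairwise disjoint. Then $$f(X\setminus(A\cup C))\cdot f(X\setminus(B\cup D))\ =\ f(X\setminus(C\cup D))\cdot f(X\setminus(A\cup B))$$ if and only if the following four conditions hold in the comparability graph $\Gamma(\mathcal{P})$: $$A\nleftrightarrow B,\qquad C\nleftrightarrow D,\qquad A\nleftrightarrow C,\qquad B\nleftrightarrow D.$$
   Context: For $S\subseteq X$, $e(S)$ is the number of linear extensions of the induced subposet on $S$, i.e. the number of bijections $\zeta:S\to\{1,\dots,|S|\}$ such that $x\prec y$ implies $\zeta(x)<\zeta(y)$; and $f(S)=e(S)/|S|!$. A subset $S\subseteq X$ is a lower order ideal if $x\in S$ and $y\prec x$ imply $y\in S$; it is an upper order ideal if $x\in S$ and $y\succ x$ imply $y\in S$. The comparability graph $\Gamma(\mathcal{P})$ is the simple graph with vertex set $X$ whose edges are the pairs $x,y$ with $x\prec y$ or $y\prec x$. For subsets $S,T\subseteq X$, write $S\leftrightarrow T$ if some vertex of $S$ and some vertex of $T$ lie in the same connected component of $\Gamma(\mathcal{P})$ (are joined by a path), and $S\nleftrightarrow T$ otherwise. *)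

theory Defs
  imports Complex_Main "HOL-Library.FuncSet" "Graph_Theory.Pair_Digraph"
begin

text \<open>
  A poset is a carrier \<open>X\<close> with a (reflexive) order \<open>r\<close> such that
  \<^prop>\<open>partial_order_on X r\<close>; the strict order is the relation without its diagonal.
\<close>

definition prec :: "'a rel \<Rightarrow> 'a \<Rightarrow> 'a \<Rightarrow> bool" where
  "prec r x y \<longleftrightarrow> (x, y) \<in> r \<and> x \<noteq> y"

text \<open>
  Bijections \<open>S \<rightarrow> {1, \<dots>, |S|}\<close> are represented by functions that are \<open>undefined\<close> outside
  \<open>S\<close> (the extensional function space), so that each of them is counted exactly once.
\<close>

definition linear_extensions :: "'a rel \<Rightarrow> 'a set \<Rightarrow> ('a \<Rightarrow> nat) set" where
  "linear_extensions r S =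
     {\<zeta> \<in> S \<rightarrow>\<^sub>E {1..card S}. bij_betw \<zeta> S {1..card S} \<and>
        (\<forall>x\<in>S. \<forall>y\<in>S. prec r x y \<longrightarrow> \<zeta> x < \<zeta> y)}"

definition num_linear_extensions :: "'a rel \<Rightarrow> 'a set \<Rightarrow> nat" where
  "num_linear_extensions r S = card (linear_extensions r S)"

definition lin_ext_ratio :: "'a rel \<Rightarrow> 'a set \<Rightarrow> real" where
  "lin_ext_ratio r S = real (num_linear_extensions r S) / fact (card S)"

definition lower_order_ideal :: "'a set \<Rightarrow> 'a rel \<Rightarrow> 'a set \<Rightarrow> bool" where
  "lower_order_ideal X r S \<longleftrightarrow> S \<subseteq> X \<and> (\<forall>x\<in>S. \<forall>y\<in>X. prec r y x \<longrightarrow> y \<in> S)"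

definition upper_order_ideal :: "'a set \<Rightarrow> 'a rel \<Rightarrow> 'a set \<Rightarrow> bool" where
  "upper_order_ideal X r S \<longleftrightarrow> S \<subseteq> X \<and> (\<forall>x\<in>S. \<forall>y\<in>X. prec r x y \<longrightarrow> y \<in> S)"

text \<open>
  Simple graphs are loop-free symmetric digraphs, every edge being present as a pair of
  opposite arcs (the locale \<^locale>\<open>pair_graph\<close>).
\<close>

definition comparability_graph :: "'a set \<Rightarrow> 'a rel \<Rightarrow> 'a pair_pre_digraph" where
  "comparability_graph X r =
     \<lparr> pverts = X, parcs = {(x, y). x \<in> X \<and> y \<in> X \<and> (prec r x y \<or> prec r y x)} \<rparr>"

lemma pair_graph_comparability_graph:
  assumes "finite X"
  shows "pair_graph (comparability_graph X r)"
proof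
  show "finite (parcs (comparability_graph X r))"
    by (rule finite_subset[of _ "X \<times> X"]) (auto simp: comparability_graph_def assms)
qed (auto simp: comparability_graph_def assms prec_def symmetric_def sym_def)

text \<open>
  In a symmetric digraph, two vertices lie in the same connected component iff one is
  reachable from the other; reachability includes the trivial path at a vertex.
\<close>

definition linked :: "'a set \<Rightarrow> 'a rel \<Rightarrow> 'a set \<Rightarrow> 'a set \<Rightarrow> bool" where
  "linked X r S T \<longleftrightarrow>
     (\<exists>x\<in>S. \<exists>y\<in>T. x \<rightarrow>\<^sup>*\<^bsub>with_proj (comparability_graph X r)\<^esub> y)"

end

theory Submission
  imports Defs
begin

text \<open>
  Write \<open>f\<close> for \<^const>\<open>lin_ext_ratio\<close>. Four inequalities between pairs of ideals,
    \<^item> \<open>f (X - A) * f (X - B) \<le> f X * f (X - (A \<union> B))\<close>,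
    \<^item> \<open>f (X - C) * f (X - D) \<le> f X * f (X - (C \<union> D))\<close>,
    \<^item> \<open>f X * f (X - (A \<union> C)) \<le> f (X - A) * f (X - C)\<close>,
    \<^item> \<open>f X * f (X - (B \<union> D)) \<le> f (X - B) * f (X - D)\<close>,

  multiply, after cancelling common positive factors, to the inequality between the two sides of
  the theorem. Each of the four is strict as soon as its two ideals are linked, so equality forces
  all four pairs to be unlinked. Conversely, if they are unlinked, then every component of the
  comparability graph meets at most one of \<open>A \<union> D\<close> and \<open>B \<union> C\<close>; as \<open>f\<close> is multiplicative over
  unions of components, both sides are the same product of four factors.

  Each of the four inequalities telescopes, by removing one extremal element at a time, to the case
  of two single elements, where it says that two minimal (or two maximal) elements attract and a
  minimal and a maximal element repel. These cases are proved together by induction on the poset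
  (\<open>removal_correlation\<close>), and the only input is the recurrence \<open>|S| * f S = (\<Sum>m. f (S - {m}))\<close>
  over the maximal elements \<open>m\<close> of \<open>S\<close>. It says that the ratios \<open>f (S - T - {m}) / f (S - T)\<close> add
  up to the integer \<open>|S - T|\<close>. For two elements \<open>s\<close>, \<open>t\<close> take these ratios for the four sets \<open>T\<close>
  between \<open>{}\<close> and \<open>{s, t}\<close>. For each single \<open>m\<close> the induction hypothesis (and, for repulsion, the
  attraction already obtained for \<open>S\<close>) compares them, and summing over \<open>m\<close> turns these comparisons into \<open>K * (R - 1) \<ge> 0\<close> with \<open>K > 0\<close>, where \<open>R\<close> is the quotient
  of the two sides that are being compared. One strict comparison makes \<open>R > 1\<close>, and a path joining
  \<open>s\<close> and \<open>t\<close> always supplies one.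
\<close>

section \<open>Connectedness in induced comparability graphs\<close>

definition comparable_in :: "'a rel \<Rightarrow> 'a set \<Rightarrow> 'a rel" where
  "comparable_in r S = {(x, y). x \<in> S \<and> y \<in> S \<and> (prec r x y \<or> prec r y x)}"

definition conn :: "'a rel \<Rightarrow> 'a set \<Rightarrow> 'a \<Rightarrow> 'a \<Rightarrow> bool" where
  "conn r S x y \<longleftrightarrow> (x, y) \<in> (comparable_in r S)\<^sup>*"

lemma prec_converse [simp]: "prec (r\<inverse>) x y \<longleftrightarrow> prec r y x"
  by (auto simp: prec_def)

lemma conn_converse [simp]: "conn (r\<inverse>) S = conn r S"
proof -
  have "comparable_in (r\<inverse>) S = comparable_in r S"
    by (auto simp: comparable_in_def)
  then show ?thesis by (simp add: conn_def fun_eq_iff)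
qed

lemma conn_refl [simp]: "conn r S x x"
  by (simp add: conn_def)

lemma conn_trans: "conn r S x y \<Longrightarrow> conn r S y z \<Longrightarrow> conn r S x z"
  by (simp add: conn_def)

lemma conn_sym: "conn r S x y \<Longrightarrow> conn r S y x"
  unfolding conn_def
  by (rule symD[OF sym_rtrancl]) (auto simp: sym_def comparable_in_def)

lemma conn_mono: "conn r S x y \<Longrightarrow> S \<subseteq> T \<Longrightarrow> conn r T x y"
  unfolding conn_def
  by (erule rtrancl_mono[THEN subsetD, rotated]) (auto simp: comparable_in_def)

lemma conn_edge: "(x, y) \<in> comparable_in r S \<Longrightarrow> conn r S x y"
  by (auto simp: conn_def)

lemma conn_neighbour:
  assumes "conn r S x y" "x \<noteq> y"
  shows "x \<in> S \<and> (\<exists>z\<in>S. prec r x z \<or> prec r z x)"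
  using assms(1)[unfolded conn_def]
  by (cases rule: converse_rtranclE) (use assms(2) in \<open>auto simp: comparable_in_def\<close>)

lemma conn_avoid: "conn r S x y \<Longrightarrow> conn r (S - {z}) x y \<or> conn r S z y"
  unfolding conn_def
proof (induction rule: converse_rtrancl_induct)
  case (step u v)
  show ?case
  proof (cases "u = z \<or> v = z")
    case True
    with step show ?thesis by (auto intro: converse_rtrancl_into_rtrancl)
  next
    case False
    with step.hyps(1) have "(u, v) \<in> comparable_in r (S - {z})"
      by (auto simp: comparable_in_def)
    with step.IH show ?thesis by (auto intro: converse_rtrancl_into_rtrancl)
  qed
qed auto

lemma conn_last_step:
  assumes "conn r S x y" "x \<noteq> y"
  shows "\<exists>w. (w, y) \<in> comparable_in r S \<and> conn r (S - {y}) x w"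
  using assms unfolding conn_def
proof (induction rule: converse_rtrancl_induct)
  case (step u v)
  show ?case
  proof (cases "v = y")
    case True
    with step.hyps(1) show ?thesis by auto
  next
    case False
    with step obtain w where w: "(w, y) \<in> comparable_in r S" "(v, w) \<in> (comparable_in r (S - {y}))\<^sup>*"
      by auto
    have "(u, v) \<in> comparable_in r (S - {y})"
      using step.hyps(1) step.prems False by (auto simp: comparable_in_def)
    with w show ?thesis by (auto intro: converse_rtrancl_into_rtrancl)
  qed
qed auto

text \<open>
  Applied in both directions, this says that a path from \<open>a\<close> to \<open>b\<close> either can be chosen to avoid
  \<open>m\<close>, or reaches \<open>m\<close> from each end without touching the other end. Indeed, cut a path just before
  its first visit to \<open>b\<close>; then \<open>b\<close> is gone from the initial piece, and \<open>m\<close> is or is not on it.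
\<close>

lemma conn_cut_vertex:
  assumes "conn r S a b" "a \<noteq> b" "m \<noteq> b"
  shows "conn r (S - {m}) a b \<or> conn r (S - {b}) a m"
proof -
  obtain w where w: "(w, b) \<in> comparable_in r S" "conn r (S - {b}) a w"
    using conn_last_step[OF assms(1,2)] by auto
  show ?thesis
  proof (cases "w = m \<or> conn r (S - {b}) m w")
    case True
    with w(2) show ?thesis by (auto dest: conn_sym intro: conn_trans)
  next
    case False
    then have "conn r (S - {b} - {m}) a w" using conn_avoid[OF w(2), of m] by auto
    then have "conn r (S - {m}) a w" by (rule conn_mono) auto
    moreover have "conn r (S - {m}) w b"
      using w(1) False assms(3) by (intro conn_edge) (auto simp: comparable_in_def)
    ultimately show ?thesis by (blast intro: conn_trans)
  qed
qed

lemma linked_iff_conn: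
  assumes "A \<subseteq> X"
  shows "linked X r A B \<longleftrightarrow> (\<exists>x\<in>A. \<exists>y\<in>B. conn r X x y)"
proof -
  have ends: "arcs_ends (with_proj (comparability_graph X r)) = comparable_in r X"
    by (auto simp: arcs_ends_def comparability_graph_def comparable_in_def arc_to_ends_def)
  have "(x \<rightarrow>\<^sup>*\<^bsub>with_proj (comparability_graph X r)\<^esub> y) \<longleftrightarrow> conn r X x y" if "x \<in> X" for x y
  proof -
    have "(x \<rightarrow>\<^sup>*\<^bsub>with_proj (comparability_graph X r)\<^esub> y) \<longleftrightarrow> (x, y) \<in> rtrancl_on X (comparable_in r X)"
      unfolding reachable_def ends by (simp add: comparability_graph_def)
    also have "\<dots> \<longleftrightarrow> conn r X x y"
    proof
      show "conn r X x y" if "(x, y) \<in> rtrancl_on X (comparable_in r X)"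
        using that unfolding conn_def by (rule rtrancl_on_rtranclI)
      show "(x, y) \<in> rtrancl_on X (comparable_in r X)" if "conn r X x y"
        using that unfolding conn_def
        by (induction rule: rtrancl_induct)
           (auto simp: \<open>x \<in> X\<close> comparable_in_def intro: rtrancl_on_into_rtrancl_on)
    qed
    finally show ?thesis .
  qed
  with assms show ?thesis unfolding linked_def by blast
qed

section \<open>Removing a maximal element from a linear extension\<close>

definition maxs :: "'a rel \<Rightarrow> 'a set \<Rightarrow> 'a set" where
  "maxs r S = {m \<in> S. \<forall>x\<in>S. \<not> prec r m x}"

lemma maxs_subset: "maxs r S \<subseteq> S"
  by (auto simp: maxs_def)

lemma maxs_Diff: "m \<in> maxs r S \<Longrightarrow> m \<notin> T \<Longrightarrow> m \<in> maxs r (S - T)"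
  by (auto simp: maxs_def)

lemma maxs_above:
  assumes "finite S" "trans r" "antisym r" "x \<in> S"
  shows "\<exists>m\<in>maxs r S. x = m \<or> prec r x m"
  using assms(1,4)
proof (induction "card {y \<in> S. prec r x y}" arbitrary: x rule: less_induct)
  case less
  show ?case
  proof (cases "x \<in> maxs r S")
    case False
    then obtain y where y: "y \<in> S" "prec r x y" using less.prems by (auto simp: maxs_def)
    have up: "prec r x z" if "prec r y z" for z
      using that y(2) assms(2,3) by (auto simp: prec_def dest: transD antisymD)
    have "{z \<in> S. prec r y z} \<subset> {z \<in> S. prec r x z}"
      using y up by (auto simp: prec_def)
    then have "card {z \<in> S. prec r y z} < card {z \<in> S. prec r x z}"
      using less.prems by (intro psubset_card_mono) auto
    from less.hyps[OF this less.prems(1) y(1)] y up show ?thesis by blast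
  qed auto
qed

text \<open>
  Deleting the element of largest label is a bijection; its inverse gives a maximal element
  the new largest label.
\<close>

lemma card_lin_ext_top:
  assumes "finite S" "m \<in> maxs r S"
  shows "card {\<zeta> \<in> linear_extensions r S. \<zeta> m = card S} = num_linear_extensions r (S - {m})"
proof -
  let ?n = "card S"
  have m: "m \<in> S" and top: "\<And>x. x \<in> S \<Longrightarrow> \<not> prec r m x" using assms(2) by (auto simp: maxs_def)
  have n: "?n > 0" using m assms(1) by (auto simp: card_gt_0_iff)
  have c: "card (S - {m}) = ?n - 1" using m by simp
  have iv: "{1..?n} - {?n} = {1..?n - 1}" by auto
  have "bij_betw (\<lambda>\<zeta>. restrict \<zeta> (S - {m})) {\<zeta> \<in> linear_extensions r S. \<zeta> m = ?n}
          (linear_extensions r (S - {m}))"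
  proof (rule bij_betw_byWitness[where f' = "\<lambda>\<eta>. \<eta>(m := ?n)"])
    show "\<forall>\<zeta>\<in>{\<zeta> \<in> linear_extensions r S. \<zeta> m = ?n}. (restrict \<zeta> (S - {m}))(m := ?n) = \<zeta>"
      by (auto simp: linear_extensions_def fun_eq_iff PiE_def extensional_def)
    show "\<forall>\<eta>\<in>linear_extensions r (S - {m}). restrict (\<eta>(m := ?n)) (S - {m}) = \<eta>"
      by (auto simp: linear_extensions_def fun_eq_iff PiE_def extensional_def)
    show "(\<lambda>\<zeta>. restrict \<zeta> (S - {m})) ` {\<zeta> \<in> linear_extensions r S. \<zeta> m = ?n}
            \<subseteq> linear_extensions r (S - {m})"
    proof clarify
      fix \<zeta> assume z: "\<zeta> \<in> linear_extensions r S" "\<zeta> m = ?n"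
      then have "bij_betw \<zeta> S {1..?n}" by (simp add: linear_extensions_def)
      with z(2) m have b: "bij_betw \<zeta> (S - {m}) {1..?n - 1}"
        using bij_betw_DiffI[of \<zeta> S "{1..?n}" "{m}" "{?n}"] n unfolding iv by simp
      then have b': "bij_betw (restrict \<zeta> (S - {m})) (S - {m}) {1..?n - 1}"
        by (subst bij_betw_cong[of _ _ \<zeta>]) auto
      show "restrict \<zeta> (S - {m}) \<in> linear_extensions r (S - {m})"
      proof -
        have "restrict \<zeta> (S - {m}) \<in> (S - {m}) \<rightarrow>\<^sub>E {1..?n - 1}"
          using bij_betwE[OF b] by simp
        moreover have "\<zeta> x < \<zeta> y" if "x \<in> S" "y \<in> S" "prec r x y" for x y
          using z(1) that by (simp add: linear_extensions_def)
        ultimately show ?thesis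
          unfolding linear_extensions_def c using b' by simp
      qed
    qed
    show "(\<lambda>\<eta>. \<eta>(m := ?n)) ` linear_extensions r (S - {m})
            \<subseteq> {\<zeta> \<in> linear_extensions r S. \<zeta> m = ?n}"
    proof (rule image_subsetI)
      fix \<eta> assume e: "\<eta> \<in> linear_extensions r (S - {m})"
      then have b: "bij_betw \<eta> (S - {m}) {1..?n - 1}"
        and mono: "\<And>x y. x \<in> S - {m} \<Longrightarrow> y \<in> S - {m} \<Longrightarrow> prec r x y \<Longrightarrow> \<eta> x < \<eta> y"
        and ext: "\<eta> \<in> extensional (S - {m})"
        by (auto simp: linear_extensions_def c PiE_def)
      let ?z = "\<eta>(m := ?n)"
      have b1: "bij_betw ?z (S - {m}) {1..?n - 1}"
        using b by (subst bij_betw_cong[of _ _ \<eta>]) auto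
      have "bij_betw ?z (insert m (S - {m})) (insert ?n {1..?n - 1})"
        using notIn_Un_bij_betw3[of m "S - {m}" ?z "{1..?n - 1}"] b1 n by auto
      moreover have "insert ?n {1..?n - 1} = {1..?n}" using n by auto
      ultimately have bz: "bij_betw ?z S {1..?n}" using m by (simp add: insert_absorb)
      have lt: "\<eta> x < ?n" if "x \<in> S" "x \<noteq> m" for x
      proof -
        have "\<eta> x \<in> {1..?n - 1}" using bij_betwE[OF b] that by blast
        then show ?thesis using n by auto
      qed
      have "?z x < ?z y" if xy: "x \<in> S" "y \<in> S" "prec r x y" for x y
      proof -
        have "x \<noteq> m" using top[OF xy(2)] xy(3) by auto
        then show ?thesis using mono[of x y] lt[of x] xy by (cases "y = m") simp_all
      qed
      moreover have "?z \<in> S \<rightarrow>\<^sub>E {1..?n}"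
        using bij_betwE[OF bz] ext m by (simp add: PiE_def Pi_def extensional_def)
      ultimately show "?z \<in> {\<zeta> \<in> linear_extensions r S. \<zeta> m = ?n}"
        using bz by (simp add: linear_extensions_def)
    qed
  qed
  from bij_betw_same_card[OF this] show ?thesis by (simp add: num_linear_extensions_def)
qed

lemma finite_linear_extensions: "finite S \<Longrightarrow> finite (linear_extensions r S)"
  by (rule finite_subset[of _ "S \<rightarrow>\<^sub>E {1..card S}"])
     (auto simp: linear_extensions_def intro!: finite_PiE)

lemma num_lin_ext_rec:
  assumes "finite S" "S \<noteq> {}"
  shows "num_linear_extensions r S = (\<Sum>m\<in>maxs r S. num_linear_extensions r (S - {m}))"
proof -
  let ?n = "card S"
  let ?F = "\<lambda>m. {\<zeta> \<in> linear_extensions r S. \<zeta> m = ?n}"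
  have n: "?n > 0" using assms by (simp add: card_gt_0_iff)
  have cover: "linear_extensions r S = (\<Union>m\<in>maxs r S. ?F m)"
  proof (intro equalityI subsetI)
    fix \<zeta> assume z: "\<zeta> \<in> linear_extensions r S"
    then have b: "bij_betw \<zeta> S {1..?n}" by (simp add: linear_extensions_def)
    then have "?n \<in> \<zeta> ` S" using n by (auto simp: bij_betw_def)
    then obtain m where m: "m \<in> S" "\<zeta> m = ?n" by force
    have "\<not> prec r m x" if "x \<in> S" for x
    proof
      assume "prec r m x"
      then have "\<zeta> m < \<zeta> x" using z m(1) that by (auto simp: linear_extensions_def)
      moreover have "\<zeta> x \<le> ?n" using bij_betwE[OF b] that by auto
      ultimately show False using m(2) by simp
    qed
    then show "\<zeta> \<in> (\<Union>m\<in>maxs r S. ?F m)" using z m by (auto simp: maxs_def)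
  qed auto
  have "card (\<Union>m\<in>maxs r S. ?F m) = (\<Sum>m\<in>maxs r S. card (?F m))"
  proof (rule card_UN_disjoint)
    show "finite (maxs r S)" using assms(1) maxs_subset finite_subset by metis
    show "\<forall>m\<in>maxs r S. finite (?F m)" using finite_linear_extensions[OF assms(1)] by simp
    show "\<forall>i\<in>maxs r S. \<forall>j\<in>maxs r S. i \<noteq> j \<longrightarrow> ?F i \<inter> ?F j = {}"
      by (auto simp: linear_extensions_def bij_betw_def inj_on_def maxs_def)
  qed
  also have "\<dots> = (\<Sum>m\<in>maxs r S. num_linear_extensions r (S - {m}))"
    by (intro sum.cong refl card_lin_ext_top assms)
  finally show ?thesis by (simp add: num_linear_extensions_def flip: cover)
qed

text \<open>
  The normalisation by \<open>|S|!\<close> turns the recurrence for counting linear extensions into an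
  averaging property. All later facts about \<^const>\<open>lin_ext_ratio\<close> follow from this one, from its
  value at the empty set and from its invariance under reversing the order.
\<close>

lemma lin_ext_ratio_rec:
  assumes "finite S"
  shows "real (card S) * lin_ext_ratio r S = (\<Sum>m\<in>maxs r S. lin_ext_ratio r (S - {m}))"
proof (cases "S = {}")
  case False
  then obtain n where n: "card S = Suc n" using assms by (metis card_0_eq not0_implies_Suc)
  have "real (card S) * lin_ext_ratio r S = real (num_linear_extensions r S) / fact n"
    by (simp add: lin_ext_ratio_def n del: of_nat_Suc)
  also have "\<dots> = (\<Sum>m\<in>maxs r S. real (num_linear_extensions r (S - {m})) / fact n)"
    by (simp add: num_lin_ext_rec[OF assms False] sum_divide_distrib)
  also have "\<dots> = (\<Sum>m\<in>maxs r S. lin_ext_ratio r (S - {m}))"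
    by (intro sum.cong refl) (auto simp: lin_ext_ratio_def n maxs_def)
  finally show ?thesis .
qed (simp add: maxs_def)

lemma lin_ext_ratio_empty [simp]: "lin_ext_ratio r {} = 1"
proof -
  have "linear_extensions r {} = {\<lambda>x. undefined}"
    by (auto simp: linear_extensions_def bij_betw_def)
  then show ?thesis by (simp add: lin_ext_ratio_def num_linear_extensions_def)
qed

lemma lin_ext_ratio_pos:
  assumes "finite S" "trans r" "antisym r"
  shows "lin_ext_ratio r S > 0"
  using assms(1)
proof (induction "card S" arbitrary: S rule: less_induct)
  case less
  show ?case
  proof (cases "S = {}")
    case False
    have "maxs r S \<noteq> {}" using maxs_above[OF less.prems assms(2,3)] False by blast
    moreover have "finite (maxs r S)" using less.prems maxs_subset finite_subset by metis
    moreover have "lin_ext_ratio r (S - {m}) > 0" if "m \<in> maxs r S" for m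
      using that less.prems maxs_subset[of r S] by (intro less.hyps) (auto intro: psubset_card_mono)
    ultimately have "(\<Sum>m\<in>maxs r S. lin_ext_ratio r (S - {m})) > 0" by (intro sum_pos) auto
    then have "real (card S) * lin_ext_ratio r S > 0" by (simp add: lin_ext_ratio_rec[OF less.prems])
    then show ?thesis by (simp add: zero_less_mult_iff)
  qed simp
qed

lemma linear_extensions_reverse:
  assumes "finite S" "\<zeta> \<in> linear_extensions r S"
  shows "restrict (\<lambda>x. Suc (card S) - \<zeta> x) S \<in> linear_extensions (r\<inverse>) S"
proof -
  let ?n = "card S" and ?z = "restrict (\<lambda>x. Suc (card S) - \<zeta> x) S"
  have b: "bij_betw \<zeta> S {1..?n}" and mono: "\<And>x y. x \<in> S \<Longrightarrow> y \<in> S \<Longrightarrow> prec r x y \<Longrightarrow> \<zeta> x < \<zeta> y"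
    using assms(2) by (auto simp: linear_extensions_def)
  have range: "1 \<le> \<zeta> x \<and> \<zeta> x \<le> ?n" if "x \<in> S" for x using bij_betwE[OF b] that by auto
  have "bij_betw (\<lambda>k. Suc ?n - k) {1..?n} {1..?n}"
    by (rule bij_betw_byWitness[where f' = "\<lambda>k. Suc ?n - k"]) auto
  from bij_betw_trans[OF b this] have "bij_betw ?z S {1..?n}"
    by (subst bij_betw_cong[of _ _ "(\<lambda>k. Suc ?n - k) \<circ> \<zeta>"]) auto
  moreover have "?z x < ?z y" if "x \<in> S" "y \<in> S" "prec r y x" for x y
    using mono[OF that(2,1,3)] range[OF that(1)] range[OF that(2)] that by auto
  ultimately show ?thesis
    using range by (fastforce simp: linear_extensions_def dest: bij_betwE)
qed

lemma lin_ext_ratio_converse: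
  assumes "finite S"
  shows "lin_ext_ratio (r\<inverse>) S = lin_ext_ratio r S"
proof -
  let ?F = "\<lambda>\<zeta>. restrict (\<lambda>x. Suc (card S) - \<zeta> x) S"
  have inv: "?F (?F \<zeta>) = \<zeta>" if "\<zeta> \<in> linear_extensions s S" for \<zeta> and s :: "'a rel"
  proof
    fix x
    show "?F (?F \<zeta>) x = \<zeta> x"
      using that by (cases "x \<in> S") (force simp: linear_extensions_def PiE_def extensional_def Pi_def)+
  qed
  have "bij_betw ?F (linear_extensions r S) (linear_extensions (r\<inverse>) S)"
  proof (rule bij_betw_byWitness[where f' = ?F])
    show "?F ` linear_extensions (r\<inverse>) S \<subseteq> linear_extensions r S"
      using linear_extensions_reverse[OF assms, of _ "r\<inverse>"] by auto
  qed (use inv linear_extensions_reverse[OF assms] in auto)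
  from bij_betw_same_card[OF this] show ?thesis by (simp add: lin_ext_ratio_def num_linear_extensions_def)
qed

lemma lin_ext_ratio_singleton [simp]: "lin_ext_ratio r {a} = 1"
proof -
  have "maxs r {a} = {a}" by (auto simp: maxs_def prec_def)
  with lin_ext_ratio_rec[of "{a}" r] show ?thesis by simp
qed

text \<open>
  Induction through the recurrence: a maximal element of the union is maximal in one part, so
  the two parts contribute \<open>|S|\<close> and \<open>|T|\<close> copies of the same product.
\<close>

lemma lin_ext_ratio_Un:
  assumes "finite (S \<union> T)" "S \<inter> T = {}"
    and "\<And>x y. x \<in> S \<Longrightarrow> y \<in> T \<Longrightarrow> \<not> prec r x y \<and> \<not> prec r y x"
  shows "lin_ext_ratio r (S \<union> T) = lin_ext_ratio r S * lin_ext_ratio r T"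
  using assms
proof (induction "card (S \<union> T)" arbitrary: S T rule: less_induct)
  case less
  let ?f = "lin_ext_ratio r"
  note prems = less.prems
  have fin: "finite S" "finite T" "finite (maxs r S)" "finite (maxs r T)"
    using prems(1) finite_subset[OF maxs_subset] by auto
  show ?case
  proof (cases "S \<union> T = {}")
    case False
    have un: "maxs r (S \<union> T) = maxs r S \<union> maxs r T"
      using prems(3) by (fastforce simp: maxs_def)
    have disj: "maxs r S \<inter> maxs r T = {}" using prems(2) by (auto simp: maxs_def)
    have smaller: "card (S \<union> T - {m}) < card (S \<union> T)" if "m \<in> S \<union> T" for m
      using that prems(1) by (intro psubset_card_mono) auto
    have left: "?f (S \<union> T - {m}) = ?f (S - {m}) * ?f T" if "m \<in> maxs r S" for m
    proof -
      have m: "m \<in> S" using that by (auto simp: maxs_def)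
      with prems(2) have eq: "S \<union> T - {m} = (S - {m}) \<union> T" by auto
      show ?thesis unfolding eq
        by (rule less.hyps) (use prems m smaller[of m] in \<open>auto simp flip: eq\<close>)
    qed
    have right: "?f (S \<union> T - {m}) = ?f S * ?f (T - {m})" if "m \<in> maxs r T" for m
    proof -
      have m: "m \<in> T" using that by (auto simp: maxs_def)
      with prems(2) have eq: "S \<union> T - {m} = S \<union> (T - {m})" by auto
      show ?thesis unfolding eq
        by (rule less.hyps) (use prems m smaller[of m] in \<open>auto simp flip: eq\<close>)
    qed
    have "card (S \<union> T) * ?f (S \<union> T) = (\<Sum>m\<in>maxs r S \<union> maxs r T. ?f (S \<union> T - {m}))"
      by (simp add: lin_ext_ratio_rec[OF prems(1)] un)
    also have "\<dots> = (\<Sum>m\<in>maxs r S. ?f (S - {m}) * ?f T) + (\<Sum>m\<in>maxs r T. ?f S * ?f (T - {m}))"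
      using fin disj left right by (simp add: sum.union_disjoint)
    also have "\<dots> = (\<Sum>m\<in>maxs r S. ?f (S - {m})) * ?f T + ?f S * (\<Sum>m\<in>maxs r T. ?f (T - {m}))"
      by (simp add: sum_distrib_left sum_distrib_right)
    also have "\<dots> = (card S + card T) * (?f S * ?f T)"
      using lin_ext_ratio_rec[OF fin(1), of r] lin_ext_ratio_rec[OF fin(2), of r]
      by (simp flip: lin_ext_ratio_rec[OF fin(1)] lin_ext_ratio_rec[OF fin(2)] add: algebra_simps)
    also have "card S + card T = card (S \<union> T)"
      using fin prems(2) by (simp add: card_Un_disjoint)
    finally have "real (card (S \<union> T)) * (?f (S \<union> T) - ?f S * ?f T) = 0"
      by (simp add: algebra_simps)
    moreover have "card (S \<union> T) \<noteq> 0" using prems(1) False by auto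
    ultimately show ?thesis by simp
  qed simp
qed

section \<open>Removing two extremal elements\<close>

text \<open>
  The minimal elements of a set are its maximal elements for the converse relation. Thus
  \<open>same_side (r\<inverse>)\<close> is the same property for two maximal elements.
\<close>

definition same_side :: "'a rel \<Rightarrow> 'a set \<Rightarrow> bool" where
  "same_side r S \<longleftrightarrow> (\<forall>a\<in>maxs (r\<inverse>) S. \<forall>b\<in>maxs (r\<inverse>) S. a \<noteq> b \<longrightarrow>
     lin_ext_ratio r (S - {a}) * lin_ext_ratio r (S - {b})
       \<le> lin_ext_ratio r S * lin_ext_ratio r (S - {a, b}) \<and>
     (conn r S a b \<longrightarrow> lin_ext_ratio r (S - {a}) * lin_ext_ratio r (S - {b})
       < lin_ext_ratio r S * lin_ext_ratio r (S - {a, b})))"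

definition opposite_sides :: "'a rel \<Rightarrow> 'a set \<Rightarrow> bool" where
  "opposite_sides r S \<longleftrightarrow> (\<forall>a\<in>maxs (r\<inverse>) S. \<forall>c\<in>maxs r S. a \<noteq> c \<longrightarrow>
     lin_ext_ratio r S * lin_ext_ratio r (S - {a, c})
       \<le> lin_ext_ratio r (S - {a}) * lin_ext_ratio r (S - {c}) \<and>
     (conn r S a c \<longrightarrow> lin_ext_ratio r S * lin_ext_ratio r (S - {a, c})
       < lin_ext_ratio r (S - {a}) * lin_ext_ratio r (S - {c})))"

lemma Diff_singletons:
  "S - {a} - {b} = S - {a, b}" "S - {a, b} - {c} = S - {a, b, c}"
  by auto

lemma opposite_sides_converse:
  assumes "finite S" "opposite_sides r S"
  shows "opposite_sides (r\<inverse>) S"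
proof -
  have conv: "lin_ext_ratio (r\<inverse>) (S - T) = lin_ext_ratio r (S - T)" for T
    using assms(1) by (simp add: lin_ext_ratio_converse)
  show ?thesis
    unfolding opposite_sides_def converse_converse conn_converse conv lin_ext_ratio_converse[OF assms(1)]
  proof (intro ballI impI)
    fix a c assume "a \<in> maxs r S" "c \<in> maxs (r\<inverse>) S" "a \<noteq> c"
    moreover have "{a, c} = {c, a}" by auto
    ultimately show "lin_ext_ratio r S * lin_ext_ratio r (S - {a, c})
        \<le> lin_ext_ratio r (S - {a}) * lin_ext_ratio r (S - {c}) \<and>
      (conn r S a c \<longrightarrow> lin_ext_ratio r S * lin_ext_ratio r (S - {a, c})
        < lin_ext_ratio r (S - {a}) * lin_ext_ratio r (S - {c}))"
      using assms(2) conn_sym[of r S a c] unfolding opposite_sides_def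
      by (simp add: mult.commute[of "lin_ext_ratio r (S - {a})"])
  qed
qed

text \<open>
  An element that is both minimal and maximal is comparable to nothing, so that by multiplicativity
  removing it does not change the ratio.
\<close>

lemma isolated:
  assumes "finite S" "a \<in> maxs r S" "a \<in> maxs (r\<inverse>) S"
  shows "lin_ext_ratio r (S - {a}) = lin_ext_ratio r S"
    and "b \<noteq> a \<Longrightarrow> lin_ext_ratio r (S - {a, b}) = lin_ext_ratio r (S - {b})"
    and "b \<noteq> a \<Longrightarrow> \<not> conn r S a b" and "b \<noteq> a \<Longrightarrow> \<not> conn r S b a"
proof -
  have split: "lin_ext_ratio r (T - {a}) = lin_ext_ratio r T" if "a \<in> T" "T \<subseteq> S" for T
  proof -
    have "lin_ext_ratio r ({a} \<union> (T - {a})) = lin_ext_ratio r {a} * lin_ext_ratio r (T - {a})"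
      using assms that finite_subset[OF that(2)]
      by (intro lin_ext_ratio_Un) (auto simp: maxs_def)
    with that(1) show ?thesis by (simp add: insert_absorb)
  qed
  have a: "a \<in> S" using assms(2) by (simp add: maxs_def)
  show "lin_ext_ratio r (S - {a}) = lin_ext_ratio r S" using split a by simp
  show "lin_ext_ratio r (S - {a, b}) = lin_ext_ratio r (S - {b})" if "b \<noteq> a"
    using split[of "S - {b}"] a that by (simp add: Diff_singletons insert_commute)
  show n: "\<not> conn r S a b" if "b \<noteq> a"
    using conn_neighbour[of r S a b] that assms(2,3) by (auto simp: maxs_def)
  show "\<not> conn r S b a" if "b \<noteq> a" using n[OF that] conn_sym[of r S b a] by blast
qed

lemma maxs_remove_min:
  assumes "a \<in> maxs (r\<inverse>) S" "a \<notin> maxs r S"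
  shows "maxs r (S - {a}) = maxs r S"
  using assms by (auto simp: maxs_def)

lemma sum_removal_ratio:
  assumes "finite S" "trans r" "antisym r"
  shows "(\<Sum>m\<in>maxs r S. lin_ext_ratio r (S - {m}) / lin_ext_ratio r S) = card S"
  using lin_ext_ratio_pos[OF assms] lin_ext_ratio_rec[OF assms(1), of r]
  by (simp add: nonzero_divide_eq_eq flip: sum_divide_distrib)

text \<open>
  Once a minimal element that is not maximal has been removed, the maximal elements are the same, so
  the two recurrences can be compared term by term. Strictness comes from the factors \<open>|S|\<close> and
  \<open>|S| - 1\<close> alone.
\<close>

lemma lin_ext_ratio_remove_min:
  assumes "finite S" "trans r" "antisym r" "a \<in> maxs (r\<inverse>) S"
  shows "lin_ext_ratio r S \<le> lin_ext_ratio r (S - {a})"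
    and "a \<notin> maxs r S \<Longrightarrow> lin_ext_ratio r S < lin_ext_ratio r (S - {a})"
proof -
  let ?f = "lin_ext_ratio r"
  have "?f S \<le> ?f (S - {a}) \<and> (a \<notin> maxs r S \<longrightarrow> ?f S < ?f (S - {a}))"
    using assms(1,4)
  proof (induction S rule: finite_psubset_induct)
    case (psubset S)
    show ?case
    proof (cases "a \<in> maxs r S")
      case True
      then show ?thesis using isolated(1)[OF psubset.hyps(1) True psubset.prems] by simp
    next
      case False
      have a: "a \<in> S" using psubset.prems by (simp add: maxs_def)
      have "card S * ?f S = (\<Sum>m\<in>maxs r S. ?f (S - {m}))"
        by (rule lin_ext_ratio_rec[OF psubset.hyps(1)])
      also have "\<dots> \<le> (\<Sum>m\<in>maxs r S. ?f (S - {a} - {m}))"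
      proof (rule sum_mono)
        fix m assume m: "m \<in> maxs r S"
        then have "S - {m} \<subset> S" "a \<in> maxs (r\<inverse>) (S - {m})"
          using False maxs_subset[of r S] maxs_Diff[OF psubset.prems, of "{m}"] by auto
        from psubset.IH[OF this] show "?f (S - {m}) \<le> ?f (S - {a} - {m})"
          by (simp add: Diff_singletons insert_commute)
      qed
      also have "\<dots> = card (S - {a}) * ?f (S - {a})"
        using lin_ext_ratio_rec[of "S - {a}" r] psubset.hyps(1)
        by (simp add: maxs_remove_min[OF psubset.prems False])
      also have "\<dots> < card S * ?f (S - {a})"
        using lin_ext_ratio_pos[of "S - {a}" r] assms(2,3) psubset.hyps(1)
          card_Diff1_less[OF psubset.hyps(1) a]
        by (intro mult_strict_right_mono) simp_all
      finally have "?f S < ?f (S - {a})" by (simp add: mult_less_cancel_left)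
      then show ?thesis by simp
    qed
  qed
  then show "?f S \<le> ?f (S - {a})" "a \<notin> maxs r S \<Longrightarrow> ?f S < ?f (S - {a})" by auto
qed

text \<open>
  The gain over the lower bound, multiplied by \<open>v\<close>, is exactly the sum of the slacks in the second
  and the third hypothesis. In the applications the second hypothesis is the inequality to be proved,
  for the poset without \<open>m\<close>, unless it reads \<open>0 \<le> 0\<close>; the third one holds because \<open>p\<close> and \<open>q\<close> lie on the same side of \<open>v\<close>.
\<close>

lemma exchange_bound:
  fixes R u v p q :: real
  assumes "v > 0" "p * q \<le> R * u * v" "(p - v) * (q - v) \<ge> 0"
  shows "(R - 1) * v \<le> R * (u + v) - p - q"
    and "p * q < R * u * v \<or> (p - v) * (q - v) > 0 \<Longrightarrow> (R - 1) * v < R * (u + v) - p - q"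
proof -
  have id: "v * (R * (u + v) - p - q - (R - 1) * v) = (R * u * v - p * q) + (p - v) * (q - v)"
    by (simp add: algebra_simps)
  have "0 \<le> v * (R * (u + v) - p - q - (R - 1) * v)" unfolding id using assms by simp
  then show "(R - 1) * v \<le> R * (u + v) - p - q" using assms(1) by (simp add: zero_le_mult_iff)
  assume "p * q < R * u * v \<or> (p - v) * (q - v) > 0"
  then have "0 < v * (R * (u + v) - p - q - (R - 1) * v)" unfolding id using assms by auto
  then show "(R - 1) * v < R * (u + v) - p - q" using assms(1) by (simp add: zero_less_mult_iff)
qed

text \<open>
  The equation \<open>total\<close> holds in the applications because the four sums count elements, up to terms
  that cancel, so that \<open>R\<close> enters only through \<open>R - 1\<close>. The previous bounds add up to
  \<open>(R - 1) * sum v M\<close>, and as \<open>sum v M < K\<close> the difference to the total, which is nonnegative, is a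
  positive multiple of \<open>R - 1\<close>.
\<close>

lemma exchange_sum:
  fixes R :: real and u v p q :: "'b \<Rightarrow> real"
  assumes "finite M" and pos: "\<And>m. m \<in> M \<Longrightarrow> v m > 0"
    and "\<And>m. m \<in> M \<Longrightarrow> p m * q m \<le> R * u m * v m"
    and "\<And>m. m \<in> M \<Longrightarrow> (p m - v m) * (q m - v m) \<ge> 0"
    and total: "R * (sum u M + sum v M) - sum p M - sum q M = K * (R - 1)"
    and K: "K - sum v M > 0"
  shows "R \<ge> 1"
    and "\<exists>m\<in>M. p m * q m < R * u m * v m \<or> (p m - v m) * (q m - v m) > 0 \<Longrightarrow> R > 1"
proof -
  have sums: "(\<Sum>m\<in>M. R * (u m + v m) - p m - q m) = K * (R - 1)"
    unfolding total[symmetric] by (simp add: sum_subtractf sum.distrib flip: sum_distrib_left)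
  have le: "(R - 1) * v m \<le> R * (u m + v m) - p m - q m" if "m \<in> M" for m
    using that assms by (intro exchange_bound) auto
  then have "(\<Sum>m\<in>M. (R - 1) * v m) \<le> K * (R - 1)" unfolding sums[symmetric] by (rule sum_mono)
  then have "0 \<le> (K - sum v M) * (R - 1)"
    unfolding sum_distrib_left[symmetric] by (simp add: algebra_simps)
  with K show "R \<ge> 1" by (simp add: zero_le_mult_iff)
  assume "\<exists>m\<in>M. p m * q m < R * u m * v m \<or> (p m - v m) * (q m - v m) > 0"
  then obtain m where m: "m \<in> M" and s: "p m * q m < R * u m * v m \<or> (p m - v m) * (q m - v m) > 0"
    by auto
  have "(R - 1) * v m < R * (u m + v m) - p m - q m"
    using m s assms by (intro exchange_bound) auto
  with m le assms(1) have "(\<Sum>m\<in>M. (R - 1) * v m) < K * (R - 1)"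
    unfolding sums[symmetric] by (intro sum_strict_mono_ex1) auto
  then have "0 < (K - sum v M) * (R - 1)"
    unfolding sum_distrib_left[symmetric] by (simp add: algebra_simps)
  with K show "R > 1" by (simp add: zero_less_mult_iff)
qed

text \<open>
  The four ratios at a maximal element \<open>m\<close> are those for removing nothing (\<open>u\<close>), \<open>a\<close> (\<open>p\<close>), \<open>b\<close> (\<open>q\<close>)
  or both (\<open>v\<close>) beforehand. Comparing with \<open>v\<close> rather than \<open>u\<close> is what makes the induction work: \<open>v \<le> p\<close>
  is the repulsion of \<open>b\<close> and \<open>m\<close> in \<open>S - {a}\<close>, a smaller poset, whereas \<open>p \<le> u\<close> would be a statement
  about \<open>S\<close> itself. If \<open>a\<close> and \<open>b\<close> are connected, then any maximal element \<open>m\<close> yields a strict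
  comparison: either \<open>a\<close> and \<open>b\<close> stay connected without \<open>m\<close>, or \<open>m\<close> is connected to each of them without
  the other one.
\<close>

lemma same_side_step:
  assumes fin: "finite S" and po: "trans r" "antisym r"
    and IH_same: "\<And>T. T \<subset> S \<Longrightarrow> same_side r T"
    and IH_opp: "\<And>T. T \<subset> S \<Longrightarrow> opposite_sides r T"
  shows "same_side r S"
  unfolding same_side_def
proof (intro ballI impI)
  fix a b assume a: "a \<in> maxs (r\<inverse>) S" and b: "b \<in> maxs (r\<inverse>) S" and ab: "a \<noteq> b"
  let ?f = "lin_ext_ratio r"
  let ?goal = "?f (S - {a}) * ?f (S - {b}) \<le> ?f S * ?f (S - {a, b}) \<and>
     (conn r S a b \<longrightarrow> ?f (S - {a}) * ?f (S - {b}) < ?f S * ?f (S - {a, b}))"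
  have aS: "a \<in> S" and bS: "b \<in> S" using a b by (auto simp: maxs_def)
  show ?goal
  proof (cases "a \<in> maxs r S \<or> b \<in> maxs r S")
    case True
    then show ?thesis
    proof
      assume "a \<in> maxs r S"
      from isolated(1)[OF fin this a] isolated(2-4)[OF fin this a, of b] ab show ?thesis by simp
    next
      assume "b \<in> maxs r S"
      from isolated(1)[OF fin this b] isolated(2-4)[OF fin this b, of a] ab show ?thesis by (simp add: insert_commute)
    qed
  next
    case False
    define M where "M = maxs r S"
    have aM: "a \<notin> M" and bM: "b \<notin> M" using False by (auto simp: M_def)
    have Ma: "maxs r (S - {a}) = M" and Mb: "maxs r (S - {b}) = M"
      unfolding M_def using a b False by (auto intro!: maxs_remove_min)
    have "maxs r (S - {a} - {b}) = maxs r (S - {a})"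
      using bM ab Ma by (intro maxs_remove_min maxs_Diff b) auto
    then have Mab: "maxs r (S - {a, b}) = M" by (simp add: Diff_singletons Ma)
    have finM: "finite M" using fin maxs_subset finite_subset unfolding M_def by metis
    have pos: "?f (S - T) > 0" for T using lin_ext_ratio_pos[OF _ po] fin by simp
    have pos0: "?f S > 0" using lin_ext_ratio_pos[OF fin po] .
    define R where "R = ?f S * ?f (S - {a, b}) / (?f (S - {a}) * ?f (S - {b}))"
    define x where "x T m = ?f (S - T - {m}) / ?f (S - T)" for T m
    have sums: "sum (x {}) M = card S" "sum (x {a}) M = card S - 1" "sum (x {b}) M = card S - 1"
         "sum (x {a, b}) M = card S - 2"
      unfolding x_def
      using sum_removal_ratio[OF fin po] sum_removal_ratio[of "S - {a}", OF _ po]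
        sum_removal_ratio[of "S - {b}", OF _ po] sum_removal_ratio[of "S - {a, b}", OF _ po]
        fin aS bS ab by (simp_all add: Ma Mb Mab card_Diff_subset flip: M_def)
    have n: "card S \<ge> 2"
      using card_mono[OF fin, of "{a, b}"] aS bS ab by simp
    have same: "?f (S - {a} - {m}) * ?f (S - {b} - {m}) \<le> ?f (S - {m}) * ?f (S - {a, b} - {m})"
      and same_strict: "conn r (S - {m}) a b \<Longrightarrow>
        ?f (S - {a} - {m}) * ?f (S - {b} - {m}) < ?f (S - {m}) * ?f (S - {a, b} - {m})"
      if m: "m \<in> M" for m
    proof -
      have "S - {m} \<subset> S" using m by (auto simp: M_def maxs_def)
      from IH_same[OF this] a b ab m aM bM
      have "?f (S - {m} - {a}) * ?f (S - {m} - {b}) \<le> ?f (S - {m}) * ?f (S - {m} - {a, b}) \<and>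
        (conn r (S - {m}) a b \<longrightarrow> ?f (S - {m} - {a}) * ?f (S - {m} - {b}) < ?f (S - {m}) * ?f (S - {m} - {a, b}))"
        unfolding same_side_def by (auto intro!: maxs_Diff)
      moreover have "S - {m} - {a} = S - {a} - {m}" "S - {m} - {b} = S - {b} - {m}"
        "S - {m} - {a, b} = S - {a, b} - {m}" by auto
      ultimately show "?f (S - {a} - {m}) * ?f (S - {b} - {m}) \<le> ?f (S - {m}) * ?f (S - {a, b} - {m})"
        "conn r (S - {m}) a b \<Longrightarrow>
          ?f (S - {a} - {m}) * ?f (S - {b} - {m}) < ?f (S - {m}) * ?f (S - {a, b} - {m})" by auto
    qed
    have opp: "?f (S - {s}) * ?f (S - {a, b} - {m}) \<le> ?f (S - {a, b}) * ?f (S - {s} - {m}) \<and>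
        (conn r (S - {s}) t m \<longrightarrow>
           ?f (S - {s}) * ?f (S - {a, b} - {m}) < ?f (S - {a, b}) * ?f (S - {s} - {m}))"
      if st: "(s = a \<and> t = b) \<or> (s = b \<and> t = a)" and m: "m \<in> M" for s t m
    proof -
      have "S - {s} \<subset> S" using st aS bS by auto
      note * = IH_opp[OF this]
      have "t \<in> maxs (r\<inverse>) (S - {s})" using st a b ab by (auto intro!: maxs_Diff)
      moreover have "m \<in> maxs r (S - {s})" using st m Ma Mb by auto
      moreover have "t \<noteq> m" using st m aM bM by auto
      moreover have "S - {s} - {t, m} = S - {a, b} - {m}" "S - {s} - {t} = S - {a, b}" using st by auto
      ultimately show ?thesis using * unfolding opposite_sides_def by metis
    qed
    have prod: "x {a} m * x {b} m \<le> R * x {} m * x {a, b} m"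
      and prod_strict: "conn r (S - {m}) a b \<Longrightarrow> x {a} m * x {b} m < R * x {} m * x {a, b} m"
      if "m \<in> M" for m
      using same[OF that] same_strict[OF that] pos[of "{a}"] pos[of "{b}"] pos[of "{a, b}"] pos0
      by (auto simp: x_def R_def divide_simps)
    have le: "x {a, b} m \<le> x {s} m" and less: "conn r (S - {s}) t m \<Longrightarrow> x {a, b} m < x {s} m"
      if "(s = a \<and> t = b) \<or> (s = b \<and> t = a)" "m \<in> M" for s t m
      using opp[OF that] pos[of "{s}"] pos[of "{a, b}"]
      by (auto simp: x_def field_simps)
    \<comment> \<open>With \<open>n = |S|\<close> the sums are \<open>n\<close>, \<open>n - 1\<close>, \<open>n - 1\<close>, \<open>n - 2\<close>, hence \<open>K = 2 * n - 2\<close> exceeds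
      the sum of \<open>v\<close> by \<open>n\<close>.\<close>
    have R: "R \<ge> 1" and R_strict: "\<exists>m\<in>M. x {a} m * x {b} m < R * x {} m * x {a, b} m \<or>
        (x {a} m - x {a, b} m) * (x {b} m - x {a, b} m) > 0 \<Longrightarrow> R > 1"
    proof -
      have v: "x {a, b} m > 0" for m
        using pos[of "{a, b}"] pos[of "{a, b, m}"] by (simp add: x_def Diff_singletons)
      have d: "(x {a} m - x {a, b} m) * (x {b} m - x {a, b} m) \<ge> 0" if "m \<in> M" for m
        using le[of a b m] le[of b a m] that by simp
      have t: "R * (sum (x {}) M + sum (x {a, b}) M) - sum (x {a}) M - sum (x {b}) M
          = (2 * card S - 2) * (R - 1)"
        unfolding sums using n by (simp add: algebra_simps)
      have K: "real (2 * card S - 2) - sum (x {a, b}) M > 0"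
        unfolding sums using n by (simp add:)
      note * = exchange_sum[where M = M and v = "x {a, b}" and p = "x {a}" and q = "x {b}" and u = "x {}",
          OF finM v prod d t K]
      show "R \<ge> 1" using *(1) by simp
      show "R > 1" if "\<exists>m\<in>M. x {a} m * x {b} m < R * x {} m * x {a, b} m \<or>
        (x {a} m - x {a, b} m) * (x {b} m - x {a, b} m) > 0" using *(2) that by simp
    qed
    have "R > 1" if c: "conn r S a b"
    proof -
      obtain m where m: "m \<in> M" using maxs_above[OF fin po aS] unfolding M_def by blast
      have ma: "m \<noteq> a" and mb: "m \<noteq> b" using m aM bM by auto
      from conn_cut_vertex[OF c ab mb] show ?thesis
      proof
        assume "conn r (S - {m}) a b"
        with prod_strict m show ?thesis by (intro R_strict) auto
      next
        assume am: "conn r (S - {b}) a m"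
        have "conn r (S - {m}) a b \<or> conn r (S - {a}) b m"
          using conn_cut_vertex[OF conn_sym[OF c] ab[symmetric] ma] by (auto dest: conn_sym)
        then show ?thesis
        proof
          assume "conn r (S - {m}) a b"
          with prod_strict m show ?thesis by (intro R_strict) auto
        next
          assume bm: "conn r (S - {a}) b m"
          have "(x {a} m - x {a, b} m) * (x {b} m - x {a, b} m) > 0"
            using less[of a b m] less[of b a m] am bm m by simp
          with m show ?thesis by (intro R_strict) auto
        qed
      qed
    qed
    with R show ?thesis
      using pos[of "{a}"] pos[of "{b}"] by (auto simp: R_def field_simps)
  qed
qed

text \<open>
  Here the roles are permuted: \<open>u\<close>, \<open>v\<close>, \<open>p\<close> and \<open>q\<close> belong to removing \<open>a\<close>, \<open>c\<close>, nothing or both, and \<open>v\<close>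
  is now the largest ratio. That \<open>p \<le> v\<close> is the attraction of the maximal elements \<open>c\<close> and \<open>m\<close>
  in \<open>S\<close> itself, which is why \<open>same_side (r\<inverse>) S\<close> is a hypothesis. The sums run over the maximal
  elements of \<open>S - {c}\<close>. Those below \<open>c\<close> do not occur in the recurrences for \<open>S\<close> and \<open>S - {a}\<close>, and there
  \<open>u\<close> and \<open>p\<close> are set to zero. The missing terms at \<open>c\<close> itself
  cancel. If \<open>a\<close> is connected to \<open>c\<close>, then it is connected in \<open>S - {c}\<close> to an element below \<open>c\<close>, hence to
  a maximal element \<open>m\<close> of \<open>S - {c}\<close> above that element, and there both comparisons with \<open>v\<close> are strict.
\<close>

lemma opposite_sides_step:
  assumes fin: "finite S" and po: "trans r" "antisym r"
    and dual: "same_side (r\<inverse>) S"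
    and IH: "\<And>T. T \<subset> S \<Longrightarrow> opposite_sides r T"
  shows "opposite_sides r S"
  unfolding opposite_sides_def
proof (intro ballI impI)
  fix a c assume a: "a \<in> maxs (r\<inverse>) S" and c: "c \<in> maxs r S" and ac: "a \<noteq> c"
  let ?f = "lin_ext_ratio r"
  have aS: "a \<in> S" and cS: "c \<in> S" using a c by (auto simp: maxs_def)
  have pos: "?f (S - T) > 0" for T using lin_ext_ratio_pos[OF _ po] fin by simp
  have pos0: "?f S > 0" using lin_ext_ratio_pos[OF fin po] .
  have aSc: "a \<in> maxs (r\<inverse>) (S - {c})" using a ac by (auto intro: maxs_Diff)
  consider "a \<in> maxs r S" | "a \<notin> maxs r S" "a \<in> maxs r (S - {c})"
    | "a \<notin> maxs r S" "a \<notin> maxs r (S - {c})" by blast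
  then show "?f S * ?f (S - {a, c}) \<le> ?f (S - {a}) * ?f (S - {c}) \<and>
     (conn r S a c \<longrightarrow> ?f S * ?f (S - {a, c}) < ?f (S - {a}) * ?f (S - {c}))"
  proof cases
    case 1
    from isolated(1)[OF fin this a] isolated(2-4)[OF fin this a, of c] ac show ?thesis by simp
  next
    case 2
    \<comment> \<open>Here only \<open>c\<close> lies above \<open>a\<close>, so removing \<open>c\<close> isolates \<open>a\<close>; removing \<open>a\<close> then changes the
      set of maximal elements, and the comparison of sums is not available.\<close>
    have "?f (S - {a, c}) = ?f (S - {c})"
      using isolated(1)[of "S - {c}", OF _ 2(2) aSc] fin by (simp add: Diff_singletons insert_commute)
    moreover have "?f S < ?f (S - {a})" by (rule lin_ext_ratio_remove_min(2)[OF fin po a 2(1)])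
    ultimately show ?thesis using pos[of "{c}"] by simp
  next
    case 3
    define M where "M = maxs r S"
    define M' where "M' = maxs r (S - {c})"
    have finM: "finite M'" using fin maxs_subset finite_subset finite_Diff unfolding M'_def by metis
    have finM0: "finite M" using fin maxs_subset finite_subset unfolding M_def by metis
    have Ma: "maxs r (S - {a}) = M" unfolding M_def using a 3(1) by (rule maxs_remove_min)
    have Mac: "maxs r (S - {a, c}) = M'"
      using maxs_remove_min[OF aSc 3(2)] by (simp add: M'_def Diff_singletons insert_commute)
    have inter: "M' \<inter> M = M - {c}" by (auto simp: M_def M'_def maxs_def)
    have cM: "c \<in> M" using c by (simp add: M_def)
    have ne: "m \<noteq> a" "m \<noteq> c" "m \<in> S" if "m \<in> M'" for m
      using that 3(2) by (auto simp: M'_def maxs_def)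
    define R where "R = ?f (S - {a}) * ?f (S - {c}) / (?f S * ?f (S - {a, c}))"
    define x where "x T m = ?f (S - T - {m}) / ?f (S - T)" for T m
    define u where "u m = (if m \<in> M then x {a} m else 0)" for m
    define p where "p m = (if m \<in> M then x {} m else 0)" for m
    have sums: "sum (x {}) M = card S" "sum (x {a}) M = card S - 1" "sum (x {c}) M' = card S - 1"
         "sum (x {a, c}) M' = card S - 2"
      unfolding x_def
      using sum_removal_ratio[OF fin po] sum_removal_ratio[of "S - {a}", OF _ po]
        sum_removal_ratio[of "S - {c}", OF _ po] sum_removal_ratio[of "S - {a, c}", OF _ po]
        fin aS cS ac
      by (simp_all add: Ma Mac card_Diff_subset flip: M_def M'_def)
    have sum_u: "sum u M' = card S - 1 - x {a} c" and sum_p: "sum p M' = card S - x {} c"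
      using sums(1,2) sum.inter_restrict[OF finM, of "x {a}" M] sum.inter_restrict[OF finM, of "x {}" M]
        sum.remove[OF finM0 cM, of "x {a}"] sum.remove[OF finM0 cM, of "x {}"]
      unfolding inter u_def p_def by simp_all
    \<comment> \<open>The two ratios at \<open>c\<close>, missing from the sums over \<open>M'\<close>, cancel in \<open>exchange_sum\<close>.\<close>
    have Rc: "R * x {a} c = x {} c"
      using pos[of "{a}"] pos[of "{c}"] pos[of "{a, c}"] pos0
      by (simp add: R_def x_def Diff_singletons)
    have n: "card S \<ge> 2" using card_mono[OF fin, of "{a, c}"] aS cS ac by simp
    have v: "x {c} m > 0" for m
      using pos[of "{c}"] pos[of "{c, m}"] by (simp add: x_def Diff_singletons)
    have prod: "p m * x {a, c} m \<le> R * u m * x {c} m" if m: "m \<in> M'" for m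
    proof (cases "m \<in> M")
      case True
      have "S - {m} \<subset> S" using ne[OF m] by auto
      from IH[OF this] a c ac ne[OF m]
      have "?f (S - {m}) * ?f (S - {m} - {a, c}) \<le> ?f (S - {m} - {a}) * ?f (S - {m} - {c})"
        unfolding opposite_sides_def by (auto intro!: maxs_Diff)
      moreover have "S - {m} - {a} = S - {a} - {m}" "S - {m} - {c} = S - {c} - {m}"
        "S - {m} - {a, c} = S - {a, c} - {m}" by auto
      ultimately show ?thesis
        using True pos[of "{a}"] pos[of "{c}"] pos[of "{a, c}"] pos0
        by (auto simp: x_def R_def p_def u_def divide_simps)
    qed (simp add: p_def u_def)
    have q_le: "x {a, c} m \<le> x {c} m" and q_less: "conn r (S - {c}) a m \<Longrightarrow> x {a, c} m < x {c} m"
      if m: "m \<in> M'" for m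
    proof -
      have "S - {c} \<subset> S" using cS by auto
      from IH[OF this] have "?f (S - {c}) * ?f (S - {c} - {a, m}) \<le> ?f (S - {c} - {a}) * ?f (S - {c} - {m}) \<and>
        (conn r (S - {c}) a m \<longrightarrow>
          ?f (S - {c}) * ?f (S - {c} - {a, m}) < ?f (S - {c} - {a}) * ?f (S - {c} - {m}))"
        unfolding opposite_sides_def using aSc m ne[OF m] by (auto simp: M'_def)
      moreover have "S - {c} - {a, m} = S - {a, c} - {m}" "S - {c} - {a} = S - {a, c}" by auto
      ultimately show "x {a, c} m \<le> x {c} m" "conn r (S - {c}) a m \<Longrightarrow> x {a, c} m < x {c} m"
        using pos[of "{c}"] pos[of "{a, c}"] by (auto simp: x_def field_simps)
    qed
    have p_le: "p m \<le> x {c} m" and p_less: "m \<in> M \<longrightarrow> conn r S c m \<Longrightarrow> p m < x {c} m"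
      if m: "m \<in> M'" for m
    proof -
      have conv: "lin_ext_ratio (r\<inverse>) (S - T) = ?f (S - T)" for T
        using fin by (simp add: lin_ext_ratio_converse)
      have "?f (S - {c}) * ?f (S - {m}) \<le> ?f S * ?f (S - {c, m}) \<and>
         (conn r S c m \<longrightarrow> ?f (S - {c}) * ?f (S - {m}) < ?f S * ?f (S - {c, m}))" if "m \<in> M"
        using dual[unfolded same_side_def converse_converse conn_converse conv
            lin_ext_ratio_converse[OF fin], THEN bspec, OF c, THEN bspec, THEN mp, of m] that ne[OF m]
        by (simp add: M_def)
      then show "p m \<le> x {c} m" "m \<in> M \<longrightarrow> conn r S c m \<Longrightarrow> p m < x {c} m"
        using pos[of "{c}"] pos0 v[of m] by (auto simp: x_def p_def field_simps Diff_singletons)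
    qed
    have d: "(p m - x {c} m) * (x {a, c} m - x {c} m) \<ge> 0" if "m \<in> M'" for m
      using p_le[OF that] q_le[OF that] by (simp add: mult_nonpos_nonpos)
    have t: "R * (sum u M' + sum (x {c}) M') - sum p M' - sum (x {a, c}) M'
        = (2 * card S - 2) * (R - 1)"
      unfolding sums sum_u sum_p using n Rc by (simp add: algebra_simps)
    have K: "real (2 * card S - 2) - sum (x {c}) M' > 0"
      unfolding sums using n by (simp add:)
    note R = exchange_sum[where M = M' and v = "x {c}" and p = p and q = "x {a, c}" and u = u,
        OF finM v prod d t K]
    have "R > 1" if linked: "conn r S a c"
    proof -
      obtain w where w: "(w, c) \<in> comparable_in r S" "conn r (S - {c}) a w"
        using conn_last_step[OF linked ac] by auto
      have w': "w \<in> S - {c}" using w(1) by (auto simp: comparable_in_def prec_def)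
      obtain m where m: "m \<in> M'" "w = m \<or> prec r w m"
        using maxs_above[of "S - {c}", OF _ po w'] fin unfolding M'_def by auto
      have wm: "conn r (S - {c}) w m"
        using m w' ne[OF m(1)] by (auto simp: comparable_in_def intro: conn_edge)
      have "conn r S c m"
        using conn_sym[OF conn_edge[OF w(1)]] conn_mono[OF wm, of S] by (auto intro: conn_trans)
      with p_less[OF m(1)] have "p m < x {c} m" by simp
      moreover have "x {a, c} m < x {c} m"
        by (rule q_less[OF m(1) conn_trans[OF w(2) wm]])
      ultimately have "(p m - x {c} m) * (x {a, c} m - x {c} m) > 0"
        by (simp add: mult_neg_neg)
      with m(1) show ?thesis by (intro R(2)) auto
    qed
    with R(1) show ?thesis
      using pos[of "{a, c}"] pos0 by (auto simp: R_def field_simps)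
  qed
qed

lemma removal_correlation:
  assumes "finite S" "trans r" "antisym r"
  shows "same_side r S" and "same_side (r\<inverse>) S" and "opposite_sides r S"
proof -
  have po: "trans (r\<inverse>)" "antisym (r\<inverse>)" using assms(2,3) by auto
  have "same_side r S \<and> same_side (r\<inverse>) S \<and> opposite_sides r S"
    using assms(1)
  proof (induction S rule: finite_psubset_induct)
    case (psubset S)
    have lower: "same_side r S"
      by (rule same_side_step[OF psubset.hyps(1) assms(2,3)]) (use psubset.IH in blast)+
    have "opposite_sides (r\<inverse>) T" if "T \<subset> S" for T
      by (rule opposite_sides_converse) (use that psubset finite_subset in blast)+
    then have upper: "same_side (r\<inverse>) S"
      by (intro same_side_step[OF psubset.hyps(1) po]) (use psubset.IH in blast)+
    have "opposite_sides r S"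
      by (rule opposite_sides_step[OF psubset.hyps(1) assms(2,3) upper]) (use psubset.IH in blast)
    with lower upper show ?case by blast
  qed
  then show "same_side r S" "same_side (r\<inverse>) S" "opposite_sides r S" by auto
qed

section \<open>From single elements to order ideals\<close>

text \<open>
  Supermodularity of \<open>h\<close> at two removed sets, strict if the sets are connected. Using
  \<open>h = ln \<circ> f\<close> for two ideals of the same kind and \<open>h = - ln \<circ> f\<close> for ideals of opposite kinds treats both
  inequalities at once and makes telescoping additive.
\<close>

definition gap :: "'a rel \<Rightarrow> ('a set \<Rightarrow> real) \<Rightarrow> 'a set \<Rightarrow> 'a set \<Rightarrow> 'a set \<Rightarrow> bool" where
  "gap r h Y A B \<longleftrightarrow> h (Y - A) + h (Y - B) \<le> h Y + h (Y - (A \<union> B)) \<and>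
     ((\<exists>a\<in>A. \<exists>b\<in>B. conn r Y a b) \<longrightarrow> h (Y - A) + h (Y - B) < h Y + h (Y - (A \<union> B)))"

lemma gap_commute: "gap r h Y A B \<longleftrightarrow> gap r h Y B A"
  unfolding gap_def using conn_sym[of r Y] by (simp add: Un_commute add.commute) blast

text \<open>
  Removes the elements of \<open>B\<close> one by one from the top. The predicate \<open>P\<close> stands for whatever
  makes \<open>A\<close> admissible in \<open>Y\<close>, so that the same induction first enlarges \<open>B\<close> against a single element
  and then \<open>A\<close> against all of \<open>B\<close>. Strictness survives because a path from \<open>A\<close> to \<open>B\<close> either passes
  through the removed element \<open>b\<close> or persists after its removal.
\<close>

lemma gap_extend:
  assumes "finite B" and po: "trans s" "antisym s"
    and single: "\<And>Y b. P Y \<Longrightarrow> b \<in> maxs s Y \<Longrightarrow> b \<notin> A \<Longrightarrow> gap r h Y A {b}"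
    and remove: "\<And>Y b. P Y \<Longrightarrow> b \<notin> A \<Longrightarrow> P (Y - {b})"
    and "P Y" "upper_order_ideal Y s B" "A \<inter> B = {}"
  shows "gap r h Y A B"
  using assms(1,6-8)
proof (induction B arbitrary: Y rule: finite_psubset_induct)
  case (psubset B)
  note up = psubset.prems(2)[unfolded upper_order_ideal_def]
  show ?case
  proof (cases "B = {}")
    case True
    then show ?thesis by (simp add: gap_def)
  next
    case False
    then obtain b where b: "b \<in> maxs s B" using maxs_above[OF psubset.hyps(1) po] by blast
    then have bB: "b \<in> B" by (simp add: maxs_def)
    then have bA: "b \<notin> A" using psubset.prems(3) by auto
    have bY: "b \<in> maxs s Y" using b up by (auto simp: maxs_def)
    have ideal: "upper_order_ideal (Y - {b}) s (B - {b})"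
      using up by (auto simp: upper_order_ideal_def)
    have rest: "gap r h (Y - {b}) A (B - {b})"
      using bB psubset.prems ideal
      by (intro psubset.IH remove bA) auto
    have first: "gap r h Y A {b}" by (rule single[OF psubset.prems(1) bY bA])
    have eq: "Y - {b} - A = Y - (A \<union> {b})" "Y - {b} - (B - {b}) = Y - B"
      "Y - {b} - (A \<union> (B - {b})) = Y - (A \<union> B)"
      using bB by auto
    have "(\<exists>a\<in>A. conn r Y a b) \<or> (\<exists>a\<in>A. \<exists>b'\<in>B - {b}. conn r (Y - {b}) a b')"
      if "a \<in> A" "b' \<in> B" "conn r Y a b'" for a b'
      using that conn_avoid[OF conn_sym[OF that(3)], of b] conn_sym by (cases "b' = b") fast+
    then show ?thesis
      using first rest unfolding gap_def eq by force
  qed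
qed

lemma gap_ideals:
  assumes fin: "finite X" and po: "trans s" "antisym s" "trans t" "antisym t"
    and single: "\<And>Y a b. finite Y \<Longrightarrow> a \<in> maxs s Y \<Longrightarrow> b \<in> maxs t Y \<Longrightarrow> a \<noteq> b \<Longrightarrow> gap r h Y {a} {b}"
    and A: "upper_order_ideal X s A" and B: "upper_order_ideal X t B" and "A \<inter> B = {}"
  shows "gap r h X A B"
proof -
  have finA: "finite A" and finB: "finite B"
    using A B fin finite_subset by (auto simp: upper_order_ideal_def)
  have one: "gap r h Y {a} B"
    if "finite Y" "upper_order_ideal Y t B" "a \<in> maxs s Y" "a \<notin> B" for Y a
    by (rule gap_extend[where P = "\<lambda>Y. finite Y \<and> a \<in> maxs s Y" and s = t])
       (use that finB po single in \<open>auto intro!: maxs_Diff\<close>)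
  have "gap r h X B A"
  proof (rule gap_extend[where P = "\<lambda>Y. finite Y \<and> upper_order_ideal Y t B" and s = s])
    show "gap r h Y B {a}" if "finite Y \<and> upper_order_ideal Y t B" "a \<in> maxs s Y" "a \<notin> B" for Y a
      using one that by (simp add: gap_commute)
    show "finite (Y - {a}) \<and> upper_order_ideal (Y - {a}) t B"
      if "finite Y \<and> upper_order_ideal Y t B" "a \<notin> B" for Y a
      using that by (auto simp: upper_order_ideal_def)
  qed (use assms finA in auto)
  then show ?thesis by (simp add: gap_commute)
qed

lemma upper_order_ideal_converse: "lower_order_ideal X r A \<Longrightarrow> upper_order_ideal X (r\<inverse>) A"
  by (auto simp: lower_order_ideal_def upper_order_ideal_def)

lemma ln_product_iff:
  fixes a b c d :: real
  assumes "a > 0" "b > 0" "c > 0" "d > 0"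
  shows "ln a + ln b \<le> ln c + ln d \<longleftrightarrow> a * b \<le> c * d"
    and "ln a + ln b < ln c + ln d \<longleftrightarrow> a * b < c * d"
proof -
  have "ln a + ln b = ln (a * b)" "ln c + ln d = ln (c * d)" using assms by (simp_all add: ln_mult)
  then show "ln a + ln b \<le> ln c + ln d \<longleftrightarrow> a * b \<le> c * d"
    "ln a + ln b < ln c + ln d \<longleftrightarrow> a * b < c * d" using assms by simp_all
qed

lemma ln_gap_same_side:
  assumes "same_side r Y" "finite Y" "trans r" "antisym r"
    and "a \<in> maxs (r\<inverse>) Y" "b \<in> maxs (r\<inverse>) Y" "a \<noteq> b"
  shows "gap r (\<lambda>S. ln (lin_ext_ratio r S)) Y {a} {b}"
proof -
  have pos: "lin_ext_ratio r Y > 0" "lin_ext_ratio r (Y - T) > 0" for T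
    using assms by (auto intro: lin_ext_ratio_pos)
  have "{a} \<union> {b} = {a, b}" by auto
  with assms(1,5-7) show ?thesis
    unfolding same_side_def gap_def by (simp only: ln_product_iff pos) blast
qed

lemma ln_gap_opposite_sides:
  assumes "finite Y" "trans r" "antisym r" "a \<in> maxs (r\<inverse>) Y" "c \<in> maxs r Y" "a \<noteq> c"
  shows "gap r (\<lambda>S. - ln (lin_ext_ratio r S)) Y {a} {c}"
proof -
  let ?f = "lin_ext_ratio r"
  have pos: "?f Y > 0" "?f (Y - T) > 0" for T
    using assms by (auto intro: lin_ext_ratio_pos)
  have "ln (?f Y) + ln (?f (Y - {a, c})) \<le> ln (?f (Y - {a})) + ln (?f (Y - {c}))"
    "conn r Y a c \<Longrightarrow> ln (?f Y) + ln (?f (Y - {a, c})) < ln (?f (Y - {a})) + ln (?f (Y - {c}))"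
    using removal_correlation(3)[OF assms(1-3)] assms(4-6)
    unfolding opposite_sides_def ln_product_iff[OF pos(1) pos(2) pos(2) pos(2)] by blast+
  moreover have "{a} \<union> {c} = {a, c}" by auto
  ultimately show ?thesis by (auto simp: gap_def)
qed

theorem theorem4p5:
  fixes X :: "'a set" and r :: "'a rel" and A B C D :: "'a set"
  assumes "finite X" and "partial_order_on X r"
    and "lower_order_ideal X r A" and "lower_order_ideal X r B"
    and "upper_order_ideal X r C" and "upper_order_ideal X r D"
    and "A \<inter> B = {}" and "A \<inter> C = {}" and "A \<inter> D = {}"
    and "B \<inter> C = {}" and "B \<inter> D = {}" and "C \<inter> D = {}"
  shows "lin_ext_ratio r (X - (A \<union> C)) * lin_ext_ratio r (X - (B \<union> D))
           = lin_ext_ratio r (X - (C \<union> D)) * lin_ext_ratio r (X - (A \<union> B))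
         \<longleftrightarrow> \<not> linked X r A B \<and> \<not> linked X r C D \<and> \<not> linked X r A C \<and> \<not> linked X r B D"
proof
  let ?f = "lin_ext_ratio r"
  let ?h = "\<lambda>S. ln (?f S)"
  have po: "trans r" "antisym r"
    using assms(2) by (auto simp: partial_order_on_def preorder_on_def)
  then have po': "trans (r\<inverse>)" "antisym (r\<inverse>)" by auto
  have sub: "A \<subseteq> X" "B \<subseteq> X" "C \<subseteq> X" "D \<subseteq> X"
    using assms(3-6) by (auto simp: lower_order_ideal_def upper_order_ideal_def)
  note lower = assms(3,4)[THEN upper_order_ideal_converse]
  note fin = \<open>finite X\<close>
  have pos: "?f (X - T) > 0" for T using fin po by (auto intro: lin_ext_ratio_pos)
  {
    assume eq: "?f (X - (A \<union> C)) * ?f (X - (B \<union> D)) = ?f (X - (C \<union> D)) * ?f (X - (A \<union> B))"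
    have AB: "gap r ?h X A B"
      by (rule gap_ideals[OF fin po' po' _ lower assms(7)])
         (auto intro: ln_gap_same_side removal_correlation po)
    have CD: "gap r ?h X C D"
    proof (rule gap_ideals[OF fin po po _ assms(5,6,12)])
      fix Y a b assume *: "finite Y" "a \<in> maxs r Y" "b \<in> maxs r Y" "a \<noteq> b"
      have "gap (r\<inverse>) (\<lambda>S. ln (lin_ext_ratio (r\<inverse>) S)) Y {a} {b}"
        using * po by (intro ln_gap_same_side removal_correlation) auto
      then show "gap r ?h Y {a} {b}"
        using *(1) by (simp add: gap_def lin_ext_ratio_converse)
    qed
    have AC: "gap r (\<lambda>S. - ?h S) X A C"
      by (rule gap_ideals[OF fin po' po _ lower(1) assms(5,8)]) (rule ln_gap_opposite_sides[OF _ po])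
    have BD: "gap r (\<lambda>S. - ?h S) X B D"
      by (rule gap_ideals[OF fin po' po _ lower(2) assms(6,11)]) (rule ln_gap_opposite_sides[OF _ po])
    have "?h (X - (A \<union> C)) + ?h (X - (B \<union> D)) = ?h (X - (C \<union> D)) + ?h (X - (A \<union> B))"
      using arg_cong[OF eq, of ln] less_imp_neq[OF pos, symmetric] by (simp add: ln_mult)
    then show "\<not> linked X r A B \<and> \<not> linked X r C D \<and> \<not> linked X r A C \<and> \<not> linked X r B D"
      using AB CD AC BD unfolding linked_iff_conn[OF sub(1)] linked_iff_conn[OF sub(2)]
        linked_iff_conn[OF sub(3)] gap_def by linarith
  }
  assume unlinked: "\<not> linked X r A B \<and> \<not> linked X r C D \<and> \<not> linked X r A C \<and> \<not> linked X r B D"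
  \<comment> \<open>The components that meet \<open>A \<union> D\<close>.\<close>
  define V where "V = {x \<in> X. \<exists>s\<in>A \<union> D. conn r X s x}"
  define W where "W = X - V"
  have VW: "X = V \<union> W" "V \<inter> W = {}" by (auto simp: V_def W_def)
  have "x \<in> V" if "x \<in> A \<union> D" for x
    using that sub(1,4) conn_refl[of r X x] unfolding V_def by blast
  moreover have "B \<inter> V = {}" "C \<inter> V = {}"
    using unlinked conn_sym[of r X] unfolding V_def linked_iff_conn[OF sub(1)]
      linked_iff_conn[OF sub(2)] linked_iff_conn[OF sub(3)] by blast+
  ultimately have parts: "X - (A \<union> C) = (V - A) \<union> (W - C)" "X - (B \<union> D) = (V - D) \<union> (W - B)"
    "X - (C \<union> D) = (V - D) \<union> (W - C)" "X - (A \<union> B) = (V - A) \<union> (W - B)"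
    using VW by auto
  have incomparable: "\<not> prec r x y \<and> \<not> prec r y x" if "x \<in> V" "y \<in> W" for x y
  proof (rule ccontr)
    assume "\<not> (\<not> prec r x y \<and> \<not> prec r y x)"
    with that have "conn r X x y" by (intro conn_edge) (auto simp: comparable_in_def V_def W_def)
    with that show False unfolding V_def W_def by (blast intro: conn_trans)
  qed
  have "?f ((V - S) \<union> (W - T)) = ?f (V - S) * ?f (W - T)" for S T
    using VW fin incomparable by (intro lin_ext_ratio_Un) (auto dest: finite_subset)
  then show "?f (X - (A \<union> C)) * ?f (X - (B \<union> D)) = ?f (X - (C \<union> D)) * ?f (X - (A \<union> B))"
    unfolding parts by simp
qed

end
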